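(* Let $\mathcal{F}$ be a class of graphs. The following statements are equivalent: (i) there is a constant $C_\mathcal{F}$ such that every $G\in\mathcal{F}$ and every neighborhood system $\Sigma$ for $G$ satisfy $\mathrm{mad}(\Sigma)\le C_\mathcal{F}\cdot\rho(\Sigma)$; (ii) there is a function $f_\mathcal{F}$ such that every $G\in\mathcal{F}$ and every neighborhood system $\Sigma$ for $G$ satisfy $\mathrm{mad}(\Sigma)\le f_\mathcal{F}(\rho(\Sigma))$; (iii) the supremum of $\mathrm{mad}(\Sigma)$ over all $G\in\mathcal{F}$ and all neighborhood systems $\Sigma$ for $G$ with $\rho(\Sigma)=2$ is finite; (iv) $\mathcal{F}$ has bounded arrangeability, i.e. there is a constant $k$ such that every graph in $\mathcal{F}$ has arrangeability at most $k$.
   Context: Graphs are finite and simple. For a graph $G=(V,E)$, a neighborhood system for $G$ is a collection $(\Sigma(v))_{v\in V}$ with $\Sigma(v)\subseteq N(v)$ (the set of neighbors of $v$), and $\rho(\Sigma)=\max_v|\Sigma(v)|$. $G_\Sigma$ is the graph on vertex set $V$ in which distinct $u,v$ are adjacent iff there is $w$ with $\{u,v\}\subseteq\Sigma(w)$. $\mathrm{mad}(\Sigma)$ is the maximum average degree of a subgraph of $G_\Sigma$ (maximum of $2|E(H)|/|V(H)|$ over nonempty subgraphs $H$). The arrangeability of $G$ is the least $k$ such that there is a linear ordering $\prec$ of $V(G)$ such that for every vertex $v$, there are at most $k$ vertices $u\prec v$ for which there exists a common neighbor $w$ of $u$ and $v$ with $v\prec w$. *)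

theory Defs
  imports "HOL-Library.Extended_Nonnegative_Real"
begin

record 'a ugraph =
  verts :: "'a set"
  edges :: "'a set set"

definition simple_graph :: "'a ugraph \<Rightarrow> bool" where
  "simple_graph G \<longleftrightarrow>
     finite (verts G) \<and> (\<forall>e\<in>edges G. e \<subseteq> verts G \<and> card e = 2)"

definition neighbors :: "'a ugraph \<Rightarrow> 'a \<Rightarrow> 'a set" where
  "neighbors G v = {u. {u, v} \<in> edges G}"

definition subgraph :: "'a ugraph \<Rightarrow> 'a ugraph \<Rightarrow> bool" where
  "subgraph H G \<longleftrightarrow> simple_graph H \<and> verts H \<subseteq> verts G \<and> edges H \<subseteq> edges G"

definition average_degree :: "'a ugraph \<Rightarrow> real" where
  "average_degree H = 2 * real (card (edges H)) / real (card (verts H))"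

text \<open>
  The graph without vertices counts as a graph here, and the two maxima below then range over
  the empty set. Since all values are nonnegative, inserting 0 changes nothing for
  other graphs and makes both maxima 0 in that case.
\<close>

definition max_average_degree :: "'a ugraph \<Rightarrow> real" where
  "max_average_degree G =
     Max (insert 0 {average_degree H |H. subgraph H G \<and> verts H \<noteq> {}})"

text \<open>
  A neighborhood system is a total function of which only the values on the vertices of \<open>G\<close> matter.
\<close>

definition neighborhood_system :: "'a ugraph \<Rightarrow> ('a \<Rightarrow> 'a set) \<Rightarrow> bool" where
  "neighborhood_system G \<Sigma> \<longleftrightarrow> (\<forall>v\<in>verts G. \<Sigma> v \<subseteq> neighbors G v)"

definition rho :: "'a ugraph \<Rightarrow> ('a \<Rightarrow> 'a set) \<Rightarrow> nat" where
  "rho G \<Sigma> = Max (insert 0 ((\<lambda>v. card (\<Sigma> v)) ` verts G))"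

definition system_graph :: "'a ugraph \<Rightarrow> ('a \<Rightarrow> 'a set) \<Rightarrow> 'a ugraph" where
  "system_graph G \<Sigma> =
     \<lparr>verts = verts G,
      edges = {{u, v} |u v. u \<in> verts G \<and> v \<in> verts G \<and> u \<noteq> v \<and>
                            (\<exists>w\<in>verts G. {u, v} \<subseteq> \<Sigma> w)}\<rparr>"

definition mad :: "'a ugraph \<Rightarrow> ('a \<Rightarrow> 'a set) \<Rightarrow> real" where
  "mad G \<Sigma> = max_average_degree (system_graph G \<Sigma>)"

definition strictly_before :: "('a \<times> 'a) set \<Rightarrow> 'a \<Rightarrow> 'a \<Rightarrow> bool" where
  "strictly_before r u v \<longleftrightarrow> (u, v) \<in> r \<and> u \<noteq> v"

definition arrangeability :: "'a ugraph \<Rightarrow> nat" where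
  "arrangeability G =
     (LEAST k. \<exists>r. linear_order_on (verts G) r \<and>
        (\<forall>v\<in>verts G.
           card {u \<in> verts G. strictly_before r u v \<and>
                   (\<exists>w \<in> neighbors G u \<inter> neighbors G v. strictly_before r v w)} \<le> k))"

end

theory Submission
  imports Defs
begin

text \<open>
  If an ordering witnesses arrangeability at most \<open>k\<close>, then every vertex has at most \<open>k + 1\<close> earlier
  neighbors, because all but the last of them are counted for that last one. Hence a vertex \<open>v\<close>
  has at most \<open>k + (k + 1) \<rho>\<close> earlier neighbors in the graph of \<open>\<Sigma>\<close>: those seen through a later
  common neighbor, and those seen through one of the earlier neighbors of \<open>v\<close>.

  Conversely, assume \<open>mad \<le> M\<close> for all systems with \<open>\<rho> = 2\<close>. Assigning pairs of \<open>A\<close> to vertices,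
  as long as this is possible with distinct pairs, shows that few vertices have more than \<open>M + 1\<close>
  neighbors in \<open>A\<close>. If many vertices of \<open>S\<close> had large degree within \<open>S\<close>, a small set \<open>A\<close> could be
  found which contains \<open>M + 2\<close> neighbors of each of many vertices; hence most vertices
  of \<open>S\<close> have bounded degree within \<open>S\<close>. The ordering is built from its end: when the vertices
  of \<open>S\<close> remain, choose one that has bounded degree within \<open>S\<close> and has few vertices of \<open>S\<close>
  at distance two through the vertices already placed. The first condition keeps the
  number of neighbors in \<open>S\<close> of placed vertices bounded, so that again the assignment
  of pairs shows that the second condition holds for most vertices of \<open>S\<close>.
\<close>

section \<open>Graphs and their average degrees\<close>

lemma neighbors_subset: "simple_graph G \<Longrightarrow> neighbors G v \<subseteq> verts G"
  by (auto simp: simple_graph_def neighbors_def)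

lemma neighbors_sym: "u \<in> neighbors G v \<longleftrightarrow> v \<in> neighbors G u"
  by (simp add: neighbors_def insert_commute)

lemma neighbors_irrefl: "simple_graph G \<Longrightarrow> v \<notin> neighbors G v"
  by (auto simp: simple_graph_def neighbors_def)

lemma simple_graph_finite_edges:
  assumes "simple_graph G" shows "finite (edges G)"
  using assms finite_subset[of "edges G" "Pow (verts G)"] by (auto simp: simple_graph_def)

text \<open>An average degree depends only on the numbers of edges and vertices, both of which are
  bounded. Finiteness makes the \<open>Max\<close> in \<open>max_average_degree\<close>
  meaningful.\<close>

lemma finite_average_degrees:
  assumes "simple_graph G"
  shows "finite {average_degree H |H. subgraph H G \<and> verts H \<noteq> {}}"
proof -
  have "{average_degree H |H. subgraph H G \<and> verts H \<noteq> {}} \<subseteq>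
      (\<lambda>(n, m). 2 * real m / real n) ` ({..card (verts G)} \<times> {..card (edges G)})"
    using assms simple_graph_finite_edges[OF assms]
    by (force simp: average_degree_def subgraph_def simple_graph_def intro: card_mono)
  then show ?thesis by (rule finite_subset) auto
qed

lemma average_degree_le_max_average_degree:
  assumes "simple_graph G" "subgraph H G" "verts H \<noteq> {}"
  shows "average_degree H \<le> max_average_degree G"
  unfolding max_average_degree_def
  using assms finite_average_degrees[OF assms(1)] by (intro Max_ge) auto

lemma max_average_degree_leI:
  assumes "simple_graph G" "0 \<le> c"
    and "\<And>H. subgraph H G \<Longrightarrow> verts H \<noteq> {} \<Longrightarrow> average_degree H \<le> c"
  shows "max_average_degree G \<le> c"
  unfolding max_average_degree_def
  using assms finite_average_degrees[OF assms(1)] by auto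

lemma simple_graph_system_graph:
  assumes "simple_graph G" shows "simple_graph (system_graph G \<Sigma>)"
  using assms by (auto simp: simple_graph_def system_graph_def)

lemma card_le_rho:
  assumes "simple_graph G" "w \<in> verts G"
  shows "card (\<Sigma> w) \<le> rho G \<Sigma>"
  using assms by (auto simp: rho_def simple_graph_def intro!: Max_ge)

text \<open>\<open>A\<close> and \<open>E\<close> form a subgraph of the graph of
  \<open>\<Sigma>\<close>. With the denominator cleared, the bound also covers empty
  \<open>A\<close>, which forces \<open>E\<close> to be empty.\<close>

lemma card_le_mad:
  assumes G: "simple_graph G" and A: "A \<subseteq> verts G"
    and E: "E \<subseteq> edges (system_graph G \<Sigma>)" "\<Union> E \<subseteq> A"
    and M: "mad G \<Sigma> \<le> M"
  shows "2 * real (card E) \<le> M * real (card A)"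
proof (cases "A = {}")
  case True
  then have "E = {}"
    using E by (auto simp: system_graph_def)
  then show ?thesis using True by simp
next
  case False
  have "finite A"
    using A G finite_subset by (auto simp: simple_graph_def)
  let ?H = "\<lparr>verts = A, edges = E\<rparr>"
  have "subgraph ?H (system_graph G \<Sigma>)"
    using A E G simple_graph_system_graph[OF G, of \<Sigma>] \<open>finite A\<close>
    by (auto simp: subgraph_def simple_graph_def system_graph_def)
  from average_degree_le_max_average_degree[OF simple_graph_system_graph[OF G] this]
  have "average_degree ?H \<le> M"
    using M False by (simp add: mad_def)
  then show ?thesis
    using False \<open>finite A\<close> by (simp add: average_degree_def field_simps card_gt_0_iff)
qed

section \<open>Assigning distinct pairs\<close>

text \<open>Maximality under inclusion suffices: a pair with both coordinates uncovered could be
  added to the matching.\<close>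

lemma maximal_matching:
  fixes R :: "('a \<times> 'b) set"
  assumes "finite R"
  obtains P where "P \<subseteq> R" "inj_on fst P" "inj_on snd P"
    "\<And>x y. (x, y) \<in> R \<Longrightarrow> x \<in> fst ` P \<or> y \<in> snd ` P"
proof -
  let ?Q = "{P. P \<subseteq> R \<and> inj_on fst P \<and> inj_on snd P}"
  have "finite ?Q" using assms by auto
  moreover have "{} \<in> ?Q" by simp
  then have "?Q \<noteq> {}" by (metis empty_iff)
  ultimately have "\<exists>P\<in>?Q. \<forall>P'\<in>?Q. P \<subseteq> P' \<longrightarrow> P = P'" by (rule finite_has_maximal)
  then obtain P where P: "P \<in> ?Q" and max: "\<And>P'. P' \<in> ?Q \<Longrightarrow> P \<subseteq> P' \<Longrightarrow> P = P'"
    by (elim bexE) (rule that, assumption, blast)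
  have "x \<in> fst ` P \<or> y \<in> snd ` P" if "(x, y) \<in> R" for x y
  proof (rule ccontr)
    assume *: "\<not> (x \<in> fst ` P \<or> y \<in> snd ` P)"
    then have "insert (x, y) P \<in> ?Q"
      using P that by auto
    with max have "(x, y) \<in> P" by blast
    with * show False by force
  qed
  with P that show ?thesis by blast
qed

text \<open>\<open>P\<close> is a maximal matching between vertices \<open>w\<close> and pairs of
  neighbors of \<open>w\<close> in \<open>A\<close>. Giving each matched vertex its pair yields a
  system whose graph has \<open>card P\<close> distinct edges within \<open>A\<close>, which bounds
  \<open>card P\<close>. At an unmatched vertex all pairs of its neighbors in \<open>A\<close> are
  used, so these neighbors form a clique; its average degree is at most \<open>M\<close>, hence it
  has fewer than \<open>M + 2\<close> vertices.\<close>

lemma pairs_assignment: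
  fixes G :: "'a ugraph" and M :: nat
  assumes G: "simple_graph G" and A: "A \<subseteq> verts G"
    and M: "\<And>\<Sigma>. neighborhood_system G \<Sigma> \<Longrightarrow> rho G \<Sigma> = 2 \<Longrightarrow> mad G \<Sigma> \<le> real M"
  obtains P :: "('a \<times> 'a set) set" where "finite P" "2 * card P \<le> M * card A"
    "\<And>w e. w \<in> verts G \<Longrightarrow> e \<subseteq> neighbors G w \<inter> A \<Longrightarrow> card e = 2 \<Longrightarrow> w \<in> fst ` P \<or> e \<in> snd ` P"
    "\<And>w. w \<in> verts G \<Longrightarrow> M + 2 \<le> card (neighbors G w \<inter> A) \<Longrightarrow> w \<in> fst ` P"
proof -
  define R where "R = {(w, e). w \<in> verts G \<and> e \<subseteq> neighbors G w \<inter> A \<and> card e = 2}"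
  have fin: "finite (verts G)" "finite A"
    using G A finite_subset by (auto simp: simple_graph_def)
  have "R \<subseteq> verts G \<times> Pow A" by (auto simp: R_def)
  then have "finite R" using fin finite_subset by blast
  then obtain P where P: "P \<subseteq> R" "inj_on fst P" "inj_on snd P"
    and sat: "\<And>x y. (x, y) \<in> R \<Longrightarrow> x \<in> fst ` P \<or> y \<in> snd ` P"
    using maximal_matching[of R] by metis
  have PD: "w \<in> verts G" "e \<subseteq> neighbors G w" "e \<subseteq> A" "card e = 2" if "(w, e) \<in> P" for w e
    using subsetD[OF P(1) that] by (auto simp: R_def)
  have finP: "finite P" using P \<open>finite R\<close> finite_subset by blast
  \<comment> \<open>As \<open>fst\<close> is injective on \<open>P\<close>, this is the single
    assigned pair of \<open>w\<close>, or empty if \<open>w\<close> is unmatched.\<close>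
  define \<Sigma> where "\<Sigma> = (\<lambda>w. \<Union> {e. (w, e) \<in> P})"
  have \<Sigma>: "\<Sigma> w = e" if "(w, e) \<in> P" for w e
  proof -
    have "e' = e" if "(w, e') \<in> P" for e'
      using inj_onD[OF P(2) _ that \<open>(w, e) \<in> P\<close>] by simp
    then have "{e'. (w, e') \<in> P} = {e}" using \<open>(w, e) \<in> P\<close> by blast
    then show ?thesis by (simp add: \<Sigma>_def)
  qed
  have \<Sigma>0: "\<Sigma> w = {}" if "w \<notin> fst ` P" for w
    using that by (force simp: \<Sigma>_def)
  have nsys: "neighborhood_system G \<Sigma>"
    using PD(2) by (auto simp: neighborhood_system_def \<Sigma>_def)
  have edges: "snd ` P \<subseteq> edges (system_graph G \<Sigma>)" "\<Union> (snd ` P) \<subseteq> A"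
  proof -
    show "snd ` P \<subseteq> edges (system_graph G \<Sigma>)"
    proof
      fix e assume "e \<in> snd ` P"
      then obtain w where w: "(w, e) \<in> P" by auto
      note e = PD(1,3,4)[OF w]
      then obtain u v where "e = {u, v}" "u \<noteq> v" by (auto simp: card_2_iff)
      then show "e \<in> edges (system_graph G \<Sigma>)"
        using e \<Sigma>[OF w] A by (auto simp: system_graph_def)
    qed
    show "\<Union> (snd ` P) \<subseteq> A" using PD(3) by fastforce
  qed
  \<comment> \<open>The hypothesis speaks of systems with \<open>\<rho>\<close> exactly 2, so at
    least one vertex must be matched.\<close>
  have mad: "mad G \<Sigma> \<le> real M" if "P \<noteq> {}"
  proof -
    have c: "card (\<Sigma> w) = (if w \<in> fst ` P then 2 else 0)" for w
    proof (cases "w \<in> fst ` P")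
      case True
      then obtain e where "(w, e) \<in> P" by auto
      then show ?thesis using True \<Sigma> PD(4) by simp
    qed (simp add: \<Sigma>0)
    obtain w e where "(w, e) \<in> P" using \<open>P \<noteq> {}\<close> by auto
    then have "w \<in> verts G" "w \<in> fst ` P" using PD(1) by force+
    then have "card (\<Sigma> w) = 2" "w \<in> verts G" using c by auto
    then have "2 \<le> rho G \<Sigma>" using card_le_rho[OF G, of w \<Sigma>] by simp
    moreover have "rho G \<Sigma> \<le> 2" using fin c by (auto simp: rho_def)
    ultimately show ?thesis using nsys M by simp
  qed
  have card: "2 * card P \<le> M * card A"
  proof (cases "P = {}")
    case False
    have "2 * real (card (snd ` P)) \<le> real M * real (card A)"
      by (rule card_le_mad[OF G A edges mad[OF False]])
    then have "real (2 * card P) \<le> real (M * card A)"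
      using card_image[OF P(3)] by simp
    then show ?thesis by linarith
  qed simp
  have "w \<in> fst ` P" if w: "w \<in> verts G" "M + 2 \<le> card (neighbors G w \<inter> A)" for w
  proof (rule ccontr)
    assume nw: "w \<notin> fst ` P"
    define K where "K = neighbors G w \<inter> A"
    have K: "finite K" "K \<subseteq> verts G" "M + 2 \<le> card K"
      using fin A w by (auto simp: K_def)
    define E where "E = {e. e \<subseteq> K \<and> card e = 2}"
    have sub: "E \<subseteq> snd ` P"
      using sat nw w by (auto simp: E_def K_def R_def)
    have cE: "card E = card K choose 2"
      unfolding E_def by (rule n_subsets[OF K(1)])
    have "2 \<le> card K" using K(3) by linarith
    then have "0 < card E" unfolding cE by simp
    then have "P \<noteq> {}" using sub by auto
    have "2 * real (card E) \<le> real M * real (card K)"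
      using card_le_mad[OF G K(2) subset_trans[OF sub edges(1)] _ mad[OF \<open>P \<noteq> {}\<close>]]
      by (auto simp: E_def)
    then have "real (2 * card E) \<le> real (M * card K)" by simp
    then have "2 * card E \<le> M * card K" by linarith
    \<comment> \<open>Evenness makes the division by 2 in \<open>choose_two\<close> exact.\<close>
    moreover have "even (card K * (card K - 1))" by (cases "card K") auto
    then have "2 * card E = card K * (card K - 1)"
      unfolding cE choose_two by (rule dvd_mult_div_cancel)
    ultimately have "card K * (card K - 1) \<le> card K * M" by (simp add: mult.commute)
    with K(3) have "card K - 1 \<le> M" by simp
    with K(3) show False by linarith
  qed
  with that finP card sat show ?thesis by (auto simp: R_def)
qed

section \<open>Choosing the next vertex\<close>

lemma sum_card_swap:
  assumes "finite S" "finite T"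
  shows "(\<Sum>v\<in>S. card {w \<in> T. Q v w}) = (\<Sum>w\<in>T. card {v \<in> S. Q v w})"
  using sum.swap_restrict[OF assms, of "\<lambda>_ _. 1 :: nat" Q] by simp

text \<open>Each \<open>w\<close> in \<open>W\<close> pays one unit per neighbor in
  \<open>A\<close>, capped at \<open>q\<close>, and each vertex of \<open>A\<close> costs
  \<open>l\<close>. An optimal \<open>A\<close> is at least as good as the empty set, which bounds
  its size. A vertex outside \<open>A\<close> has at most \<open>l\<close> neighbors in
  \<open>W\<close> below the cap, while each vertex below the cap has at least \<open>m\<close>
  neighbors in \<open>S - A\<close>; double counting bounds their number.\<close>

lemma small_multiply_dominating_set:
  fixes N :: "'a \<Rightarrow> 'a set" and q l m :: nat
  assumes S: "finite S" and W: "W \<subseteq> S"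
    and sym: "\<And>u v. u \<in> N v \<longleftrightarrow> v \<in> N u"
    and deg: "\<And>w. w \<in> W \<Longrightarrow> q + m \<le> card (N w \<inter> S)"
  obtains A where "A \<subseteq> S" "l * card A \<le> q * card S"
    "m * card {w \<in> W. card (N w \<inter> A) < q} \<le> l * card S"
proof -
  have W': "finite W" using S W finite_subset by blast
  \<comment> \<open>If \<open>A\<close> maximizes \<open>\<Phi>\<close>, adding a vertex to \<open>A\<close> raises the sum by at most \<open>l\<close>.\<close>
  define \<Phi> where "\<Phi> A = (\<Sum>w\<in>W. int (min q (card (N w \<inter> A)))) - int (l * card A)" for A
  have "Max (\<Phi> ` Pow S) \<in> \<Phi> ` Pow S" using S by (intro Max_in) auto
  then obtain A where A: "A \<subseteq> S" "\<Phi> A = Max (\<Phi> ` Pow S)" by auto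
  have max: "\<Phi> B \<le> \<Phi> A" if "B \<subseteq> S" for B
    unfolding A(2) using S that by (intro Max_ge) auto
  have A': "finite A" using S A(1) finite_subset by blast
  have "0 \<le> \<Phi> A" using max[of "{}"] by (simp add: \<Phi>_def)
  moreover have "(\<Sum>w\<in>W. int (min q (card (N w \<inter> A)))) \<le> int (q * card W)"
    using sum_bounded_above[of W "\<lambda>w. int (min q (card (N w \<inter> A)))" "int q"]
    by (simp add: mult.commute)
  ultimately have "int (l * card A) \<le> int (q * card W)" by (simp add: \<Phi>_def)
  moreover have "q * card W \<le> q * card S" using card_mono[OF S W] by simp
  ultimately have cA: "l * card A \<le> q * card S" by linarith
  define U where "U = {w \<in> W. card (N w \<inter> A) < q}"
  have U: "finite U" "U \<subseteq> W" using W' by (auto simp: U_def)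
  have gain: "card {w \<in> U. v \<in> N w} \<le> l" if v: "v \<in> S - A" for v
  proof -
    have "\<Phi> (insert v A) \<le> \<Phi> A" using max v A(1) by auto
    moreover have "card (insert v A) = card A + 1" using v A' by simp
    ultimately have "(\<Sum>w\<in>W. int (min q (card (N w \<inter> insert v A)))) -
        (\<Sum>w\<in>W. int (min q (card (N w \<inter> A)))) \<le> int l"
      by (simp add: \<Phi>_def algebra_simps)
    \<comment> \<open>A term below the cap rises by one with a new neighbor, and no term
      decreases.\<close>
    moreover have "(\<Sum>w\<in>W. if w \<in> U \<and> v \<in> N w then 1 else 0) \<le>
       (\<Sum>w\<in>W. int (min q (card (N w \<inter> insert v A))) - int (min q (card (N w \<inter> A))))"
    proof (rule sum_mono)
      fix w assume w: "w \<in> W"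
      have "card (N w \<inter> insert v A) = (if v \<in> N w then 1 else 0) + card (N w \<inter> A)"
        using v A' by simp
      then show "(if w \<in> U \<and> v \<in> N w then 1 else 0) \<le>
         int (min q (card (N w \<inter> insert v A))) - int (min q (card (N w \<inter> A)))"
        using w by (auto simp: U_def)
    qed
    moreover have "(\<Sum>w\<in>W. if w \<in> U \<and> v \<in> N w then 1 else 0) = int (card {w \<in> U. v \<in> N w})"
    proof -
      have "{w \<in> W. w \<in> U \<and> v \<in> N w} = {w \<in> U. v \<in> N w}" using U by auto
      then show ?thesis using W' by (simp flip: sum.inter_filter)
    qed
    ultimately show ?thesis by (simp add: sum_subtractf)
  qed
  have "m * card U \<le> (\<Sum>w\<in>U. card {v \<in> S - A. v \<in> N w})"
  proof -
    have "m \<le> card {v \<in> S - A. v \<in> N w}" if w: "w \<in> U" for w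
    proof -
      have "{v \<in> S - A. v \<in> N w} = (N w \<inter> S) - (N w \<inter> A)" by auto
      then have "card {v \<in> S - A. v \<in> N w} = card (N w \<inter> S) - card (N w \<inter> A)"
        using A(1) A' by (subst card_Diff_subset[symmetric]) auto
      moreover have "q + m \<le> card (N w \<inter> S)" "card (N w \<inter> A) < q"
        using w deg by (auto simp: U_def)
      ultimately show ?thesis by linarith
    qed
    then show ?thesis
      using sum_bounded_below[of U m "\<lambda>w. card {v \<in> S - A. v \<in> N w}"]
      by (simp add: mult.commute)
  qed
  also have "\<dots> = (\<Sum>v\<in>S - A. card {w \<in> U. v \<in> N w})"
    using S U by (intro sum_card_swap) auto
  also have "\<dots> \<le> card (S - A) * l"
    using sum_bounded_above[of "S - A" "\<lambda>v. card {w \<in> U. v \<in> N w}" l] gain by simp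
  also have "\<dots> \<le> l * card S"
    using S by (simp add: card_mono mult.commute)
  finally show ?thesis using that A(1) cA by (simp add: U_def)
qed

text \<open>This is \<open>q + m\<close> for the dominating set with \<open>q = M + 2\<close>,
  \<open>m = 4 * l\<close> and \<open>l = 2 * M * (M + 2) + 1\<close>. The factor 4 leaves at most a
  quarter of the vertices below the cap; the size of \<open>l\<close> makes \<open>A\<close> so
  small that at most a quarter are matched. The final 1 keeps \<open>l\<close> positive, so that it
  can be cancelled.\<close>

definition degree_bound :: "nat \<Rightarrow> nat" where
  "degree_bound M = (M + 2) + 4 * (2 * M * (M + 2) + 1)"

text \<open>A vertex of high degree either has fewer than \<open>M + 2\<close> neighbors in the
  small set \<open>A\<close> or is matched to a pair of \<open>A\<close>. Each case accounts for at
  most a quarter of \<open>S\<close>.\<close>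

lemma few_high_degree:
  fixes G :: "'a ugraph" and M :: nat
  assumes G: "simple_graph G" and S: "S \<subseteq> verts G"
    and M: "\<And>\<Sigma>. neighborhood_system G \<Sigma> \<Longrightarrow> rho G \<Sigma> = 2 \<Longrightarrow> mad G \<Sigma> \<le> real M"
  shows "2 * card {v \<in> S. degree_bound M < card (neighbors G v \<inter> S)} \<le> card S"
proof -
  define W where "W = {v \<in> S. degree_bound M < card (neighbors G v \<inter> S)}"
  define l where "l = 2 * M * (M + 2) + 1"
  have fS: "finite S" using S G finite_subset by (auto simp: simple_graph_def)
  have "W \<subseteq> S" by (auto simp: W_def)
  obtain A where A: "A \<subseteq> S" "l * card A \<le> (M + 2) * card S"
    and low: "4 * l * card {w \<in> W. card (neighbors G w \<inter> A) < M + 2} \<le> l * card S"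
    by (rule small_multiply_dominating_set[OF fS \<open>W \<subseteq> S\<close>, of "neighbors G" "M + 2" "4 * l" l])
      (auto simp: W_def l_def degree_bound_def neighbors_sym)
  define U where "U = {w \<in> W. card (neighbors G w \<inter> A) < M + 2}"
  have U: "4 * card U \<le> card S"
  proof -
    have "l * (4 * card U) \<le> l * card S" using low by (simp add: U_def ac_simps)
    then show ?thesis by (simp add: l_def del: mult_Suc)
  qed
  have AV: "A \<subseteq> verts G" using A S by auto
  obtain P :: "('a \<times> 'a set) set" where P: "finite P" "2 * card P \<le> M * card A"
    and sat: "\<And>w. w \<in> verts G \<Longrightarrow> M + 2 \<le> card (neighbors G w \<inter> A) \<Longrightarrow> w \<in> fst ` P"
    using pairs_assignment[OF G AV M] by metis
  have T: "4 * card (fst ` P) \<le> card S"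
  proof -
    have "l * (2 * card P) \<le> M * (l * card A)"
      using mult_le_mono2[OF P(2), of l] by (simp add: ac_simps)
    also have "\<dots> \<le> M * ((M + 2) * card S)" using A(2) by simp
    finally have "2 * (l * (2 * card P)) \<le> 2 * (M * ((M + 2) * card S))" by simp
    also have "\<dots> \<le> l * card S" by (simp add: l_def algebra_simps)
    finally have "l * (4 * card P) \<le> l * card S" by (simp add: ac_simps)
    then have "4 * card P \<le> card S" by (simp add: l_def del: mult_Suc)
    then show ?thesis using card_image_le[OF P(1), of fst] by linarith
  qed
  have "W \<subseteq> U \<union> fst ` P"
    using sat \<open>W \<subseteq> S\<close> S by (force simp: U_def not_less)
  moreover have "finite U" using finite_subset[OF \<open>W \<subseteq> S\<close> fS] by (simp add: U_def)
  ultimately have "card W \<le> card U + card (fst ` P)"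
    using P(1) card_mono[of "U \<union> fst ` P" W] card_Un_le[of U "fst ` P"] by simp
  then show ?thesis using U T by (simp add: W_def)
qed

text \<open>\<open>S\<close> holds the remaining vertices and its complement those already placed at
  the end. These are exactly the vertices counted for \<open>v\<close> if \<open>v\<close> becomes
  the last vertex of \<open>S\<close>.\<close>

definition placed_related :: "'a ugraph \<Rightarrow> 'a set \<Rightarrow> 'a \<Rightarrow> 'a set" where
  "placed_related G S v =
     {u \<in> S. u \<noteq> v \<and> (\<exists>w \<in> verts G - S. w \<in> neighbors G u \<inter> neighbors G v)}"

text \<open>Two vertices of \<open>S\<close> with a common placed neighbor \<open>w\<close> form a
  matched pair, or \<open>w\<close> is matched. So every element of the matching accounts for at
  most \<open>2 + D * D\<close> ordered related pairs, and the average number of related vertices is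
  at most half the threshold.\<close>

lemma few_highly_related:
  fixes G :: "'a ugraph" and M D :: nat
  assumes G: "simple_graph G" and S: "S \<subseteq> verts G" "S \<noteq> {}"
    and M: "\<And>\<Sigma>. neighborhood_system G \<Sigma> \<Longrightarrow> rho G \<Sigma> = 2 \<Longrightarrow> mad G \<Sigma> \<le> real M"
    and D: "\<And>w. w \<in> verts G - S \<Longrightarrow> card (neighbors G w \<inter> S) \<le> D"
  shows "2 * card {v \<in> S. M * (2 + D * D) < card (placed_related G S v)} < card S"
proof -
  define k where "k = M * (2 + D * D)"
  define B where "B = {v \<in> S. k < card (placed_related G S v)}"
  have fS: "finite S" using S G finite_subset by (auto simp: simple_graph_def)
  obtain P :: "('a \<times> 'a set) set" where P: "finite P" "2 * card P \<le> M * card S"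
    and sat: "\<And>w e. w \<in> verts G \<Longrightarrow> e \<subseteq> neighbors G w \<inter> S \<Longrightarrow> card e = 2 \<Longrightarrow>
       w \<in> fst ` P \<or> e \<in> snd ` P"
    using pairs_assignment[OF G S(1) M] by metis
  define J where "J = Sigma S (placed_related G S)"
  \<comment> \<open>The ordered pairs charged to one element of the matching: both orders of
    \<open>e\<close>, and all pairs of neighbors in \<open>S\<close> of \<open>w\<close> if
    \<open>w\<close> is placed, which is where \<open>D\<close> applies.\<close>
  define Q where "Q p = (case p of (w, e) \<Rightarrow>
      {(u, v). u \<noteq> v \<and> {u, v} = e} \<union>
      (if w \<in> verts G - S then (neighbors G w \<inter> S) \<times> (neighbors G w \<inter> S) else {}))"
    for p :: "'a \<times> 'a set"
  have J_sub: "J \<subseteq> (\<Union>p\<in>P. Q p)"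
  proof
    fix x assume "x \<in> J"
    then obtain v u w where x: "x = (v, u)" "u \<in> S" "v \<in> S" "u \<noteq> v" "w \<in> verts G - S"
      "w \<in> neighbors G u" "w \<in> neighbors G v"
      by (auto simp: J_def placed_related_def)
    then have N: "u \<in> neighbors G w" "v \<in> neighbors G w" using neighbors_sym by metis+
    have "w \<in> fst ` P \<or> {v, u} \<in> snd ` P" using x N by (intro sat) auto
    then obtain p where "p \<in> P" "fst p = w \<or> snd p = {v, u}" by auto
    moreover from this have "x \<in> Q p"
      using x N by (cases p) (auto simp: Q_def)
    ultimately show "x \<in> (\<Union>p\<in>P. Q p)" by blast
  qed
  have Q: "finite (Q p) \<and> card (Q p) \<le> 2 + D * D" for p
  proof -
    obtain w e where p: "p = (w, e)" by fastforce
    define X where "X = {(u, v). u \<noteq> v \<and> {u, v} = e}"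
    define Y where "Y = (if w \<in> verts G - S then (neighbors G w \<inter> S) \<times> (neighbors G w \<inter> S) else {})"
    have X: "finite X \<and> card X \<le> 2"
    proof (cases "\<exists>a b. e = {a, b}")
      case False
      then have "X = {}" by (auto simp: X_def)
      then show ?thesis by simp
    next
      case True
      then obtain a b where e: "e = {a, b}" by blast
      have sub: "X \<subseteq> {(a, b), (b, a)}" by (auto simp: X_def e doubleton_eq_iff)
      have "card X \<le> card {(a, b), (b, a)}" using sub by (rule card_mono[rotated]) simp
      also have "\<dots> \<le> 2" by (cases "a = b") auto
      finally show ?thesis using finite_subset[OF sub] by simp
    qed
    have Y: "finite Y \<and> card Y \<le> D * D"
      using fS mult_le_mono[OF D D, of w w] by (simp add: Y_def card_cartesian_product)
    have "Q p = X \<union> Y" by (simp only: p Q_def prod.case X_def Y_def)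
    moreover have "card (X \<union> Y) \<le> card X + card Y" by (rule card_Un_le)
    moreover have "finite (X \<union> Y)" using X Y by blast
    ultimately show ?thesis using X Y by simp
  qed
  have "card J \<le> card (\<Union>p\<in>P. Q p)"
    using J_sub P(1) Q by (intro card_mono) auto
  also have "\<dots> \<le> (\<Sum>p\<in>P. card (Q p))" using P(1) by (rule card_UN_le)
  also have "\<dots> \<le> card P * (2 + D * D)"
    using sum_bounded_above[of P "\<lambda>p. card (Q p)" "2 + D * D"] Q by simp
  finally have "2 * card J \<le> 2 * card P * (2 + D * D)" by simp
  also have "\<dots> \<le> M * card S * (2 + D * D)" by (rule mult_le_mono1[OF P(2)])
  finally have J: "2 * card J \<le> k * card S" by (simp add: k_def algebra_simps)
  have B: "finite B" "B \<subseteq> S" using fS by (auto simp: B_def)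
  have "(k + 1) * card B \<le> (\<Sum>v\<in>B. card (placed_related G S v))"
    using sum_bounded_below[of B "k + 1" "\<lambda>v. card (placed_related G S v)"]
    by (auto simp: B_def mult.commute Suc_le_eq)
  also have "\<dots> \<le> (\<Sum>v\<in>S. card (placed_related G S v))"
    using B fS by (intro sum_mono2) auto
  also have "\<dots> = card J"
    using fS by (simp add: J_def card_SigmaI placed_related_def)
  finally have "(k + 1) * (2 * card B) \<le> k * card S" using J by simp
  \<comment> \<open>Strictness comes from \<open>S\<close> being nonempty. It lets this bound be
    combined with a non-strict one half without exhausting \<open>S\<close>.\<close>
  also have "\<dots> < (k + 1) * card S" using fS S(2) by (simp add: card_gt_0_iff)
  finally have "2 * card B < card S" by (simp del: mult_Suc)
  then show ?thesis by (simp add: B_def k_def)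
qed

section \<open>From bounded average degrees to an ordering\<close>

text \<open>Induction on the size of \<open>S\<close>, with all vertices outside \<open>S\<close>
  regarded as later. The bound \<open>D\<close> is the invariant: it survives placing
  \<open>v\<close> because \<open>v\<close> itself has at most \<open>D\<close> neighbors in
  \<open>S\<close>.\<close>

lemma ordering_of_remaining:
  fixes G :: "'a ugraph" and M D :: nat
  assumes G: "simple_graph G"
    and M: "\<And>\<Sigma>. neighborhood_system G \<Sigma> \<Longrightarrow> rho G \<Sigma> = 2 \<Longrightarrow> mad G \<Sigma> \<le> real M"
    and D: "D = degree_bound M" and k: "k = M * (2 + D * D)"
    and S: "S \<subseteq> verts G" "\<And>w. w \<in> verts G - S \<Longrightarrow> card (neighbors G w \<inter> S) \<le> D"
  shows "\<exists>f :: 'a \<Rightarrow> nat. inj_on f S \<and> f ` S \<subseteq> {..<card S} \<and>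
     (\<forall>v\<in>S. card {u \<in> S. f u < f v \<and>
        (\<exists>w \<in> neighbors G u \<inter> neighbors G v. w \<in> verts G - S \<or> (w \<in> S \<and> f v < f w))} \<le> k)"
  using S
proof (induction "card S" arbitrary: S)
  case 0
  moreover have "finite S" using 0 G finite_subset by (auto simp: simple_graph_def)
  ultimately have "S = {}" by simp
  then show ?case by simp
next
  case (Suc n)
  have fS: "finite S" using Suc.prems G finite_subset by (auto simp: simple_graph_def)
  have "S \<noteq> {}" using Suc.hyps(2) by auto
  let ?B1 = "{v \<in> S. D < card (neighbors G v \<inter> S)}"
  let ?B2 = "{v \<in> S. k < card (placed_related G S v)}"
  \<comment> \<open>At most half of \<open>S\<close> is bad in the first sense and less than half in
    the second, so some vertex is good in both.\<close>
  have "2 * card ?B1 \<le> card S"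
    using few_high_degree[OF G Suc.prems(1) M] by (simp add: D)
  moreover have "2 * card ?B2 < card S"
    using few_highly_related[OF G Suc.prems(1) \<open>S \<noteq> {}\<close> M Suc.prems(2)] by (simp add: k)
  ultimately have "card (?B1 \<union> ?B2) < card S"
    using card_Un_le[of ?B1 ?B2] by linarith
  then have "?B1 \<union> ?B2 \<noteq> S" by auto
  then have "\<exists>v\<in>S. v \<notin> ?B1 \<and> v \<notin> ?B2" by blast
  then obtain v where v: "v \<in> S" "card (neighbors G v \<inter> S) \<le> D"
    "card (placed_related G S v) \<le> k"
    by (auto simp: not_less)
  define T where "T = S - {v}"
  have T: "n = card T" "T \<subseteq> verts G" "S = insert v T" "v \<notin> T" "finite T"
    using v fS Suc.hyps(2) Suc.prems(1) by (auto simp: T_def)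
  have "card (neighbors G w \<inter> T) \<le> D" if "w \<in> verts G - T" for w
  proof -
    have "card (neighbors G w \<inter> T) \<le> card (neighbors G w \<inter> S)"
      using fS T by (intro card_mono) auto
    also have "\<dots> \<le> D" using that v(2) Suc.prems(2)[of w] T by auto
    finally show ?thesis .
  qed
  from Suc.hyps(1)[OF T(1,2) this] obtain f :: "'a \<Rightarrow> nat"
    where f: "inj_on f T" "f ` T \<subseteq> {..<n}" and
      fk: "\<And>x. x \<in> T \<Longrightarrow> card {u \<in> T. f u < f x \<and>
        (\<exists>w \<in> neighbors G u \<inter> neighbors G x. w \<in> verts G - T \<or> (w \<in> T \<and> f x < f w))} \<le> k"
    using T(1) by auto
  define g where "g = f(v := n)"
  have gT: "g x = f x" "g x < n" if "x \<in> T" for x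
    using that f(2) T(4) by (auto simp: g_def)
  have gv: "g v = n" by (simp add: g_def)
  have "inj_on g S" unfolding T(3)
    using f gT gv by (auto simp: inj_on_def dest: less_imp_neq)
  moreover have "g ` S \<subseteq> {..<card S}"
    using gT gv Suc.hyps(2) unfolding T(3) by force
  moreover have "card {u \<in> S. g u < g x \<and>
      (\<exists>w \<in> neighbors G u \<inter> neighbors G x. w \<in> verts G - S \<or> (w \<in> S \<and> g x < g w))} \<le> k"
    (is "card ?L \<le> k") if x: "x \<in> S" for x
  proof (cases "x = v")
    case True
    \<comment> \<open>No vertex of \<open>S\<close> comes after \<open>v\<close>, so only placed
      common neighbors remain.\<close>
    have "?L \<subseteq> placed_related G S v"
      using gT gv True unfolding T(3) by (force simp: placed_related_def)
    then have "card ?L \<le> card (placed_related G S v)"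
      using fS by (intro card_mono) (auto simp: placed_related_def)
    then show ?thesis using v(3) by simp
  next
    case False
    then have "x \<in> T" using x T by auto
    have "?L \<subseteq> {u \<in> T. f u < f x \<and>
        (\<exists>w \<in> neighbors G u \<inter> neighbors G x. w \<in> verts G - T \<or> (w \<in> T \<and> f x < f w))}"
    proof
      fix u assume u: "u \<in> ?L"
      then have "u \<in> T" using gT[OF \<open>x \<in> T\<close>] gv T(3) by auto
      \<comment> \<open>A common neighbor \<open>v\<close>, later than \<open>x\<close> within
        \<open>S\<close>, counts as placed with respect to \<open>T\<close>.\<close>
      moreover have "v \<in> verts G - T" using T(3,4) Suc.prems(1) by auto
      ultimately show "u \<in> {u \<in> T. f u < f x \<and>
        (\<exists>w \<in> neighbors G u \<inter> neighbors G x. w \<in> verts G - T \<or> (w \<in> T \<and> f x < f w))}"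
        using u gT \<open>x \<in> T\<close> T(3) by auto
    qed
    then have "card ?L \<le> card {u \<in> T. f u < f x \<and>
        (\<exists>w \<in> neighbors G u \<inter> neighbors G x. w \<in> verts G - T \<or> (w \<in> T \<and> f x < f w))}"
      using T(5) by (intro card_mono) auto
    then show ?thesis using fk[OF \<open>x \<in> T\<close>] by linarith
  qed
  ultimately show ?case by blast
qed

lemma linear_order_on_inj:
  fixes f :: "'a \<Rightarrow> 'b::linorder"
  assumes "inj_on f V"
  shows "linear_order_on V {(u, v). u \<in> V \<and> v \<in> V \<and> f u \<le> f v}"
  using assms
  by (auto simp: linear_order_on_def partial_order_on_def preorder_on_def refl_on_def
      trans_on_def antisym_on_def total_on_def inj_on_def)

lemma arrangeability_bound:
  fixes G :: "'a ugraph" and M :: nat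
  assumes G: "simple_graph G"
    and M: "\<And>\<Sigma>. neighborhood_system G \<Sigma> \<Longrightarrow> rho G \<Sigma> = 2 \<Longrightarrow> mad G \<Sigma> \<le> real M"
  shows "arrangeability G \<le> M * (2 + degree_bound M * degree_bound M)"
proof -
  define k where "k = M * (2 + degree_bound M * degree_bound M)"
  define V where "V = verts G"
  have V: "finite V" using G by (simp add: V_def simple_graph_def)
  \<comment> \<open>Initially nothing is placed, so the invariant holds vacuously.\<close>
  obtain f :: "'a \<Rightarrow> nat" where f: "inj_on f V" and
    fk: "\<And>v. v \<in> V \<Longrightarrow> card {u \<in> V. f u < f v \<and>
       (\<exists>w \<in> neighbors G u \<inter> neighbors G v. w \<in> V \<and> f v < f w)} \<le> k"
    using ordering_of_remaining[OF G M refl refl, of V] unfolding k_def V_def by auto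
  define r where "r = {(u, v). u \<in> V \<and> v \<in> V \<and> f u \<le> f v}"
  have r: "strictly_before r u v \<longleftrightarrow> u \<in> V \<and> v \<in> V \<and> f u < f v" for u v
    using f by (auto simp: strictly_before_def r_def inj_on_def order_less_le)
  have lin: "linear_order_on V r"
    unfolding r_def by (rule linear_order_on_inj[OF f])
  have "card {u \<in> V. strictly_before r u v \<and>
       (\<exists>w \<in> neighbors G u \<inter> neighbors G v. strictly_before r v w)} \<le> k" if v: "v \<in> V" for v
  proof -
    have "{u \<in> V. strictly_before r u v \<and>
        (\<exists>w \<in> neighbors G u \<inter> neighbors G v. strictly_before r v w)} =
      {u \<in> V. f u < f v \<and> (\<exists>w \<in> neighbors G u \<inter> neighbors G v. w \<in> V \<and> f v < f w)}"
      using v by (auto simp: r)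
    then show ?thesis using fk[OF v] by simp
  qed
  with lin show ?thesis
    unfolding arrangeability_def k_def[symmetric] V_def by (intro Least_le) blast
qed

section \<open>From an ordering to bounded average degrees\<close>

text \<open>The least value is attained, since any linear order witnesses the bound
  \<open>card (verts G)\<close>.\<close>

lemma arrangeability_witness:
  fixes G :: "'a ugraph"
  assumes G: "simple_graph G"
  obtains r where "linear_order_on (verts G) r"
    "\<forall>v\<in>verts G. card {u \<in> verts G. strictly_before r u v \<and>
        (\<exists>w \<in> neighbors G u \<inter> neighbors G v. strictly_before r v w)} \<le> arrangeability G"
proof -
  let ?P = "\<lambda>k. \<exists>r. linear_order_on (verts G) r \<and>
        (\<forall>v\<in>verts G.
           card {u \<in> verts G. strictly_before r u v \<and>
                   (\<exists>w \<in> neighbors G u \<inter> neighbors G v. strictly_before r v w)} \<le> k)"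
  obtain r where "linear_order_on (verts G) r"
    using well_order_on[of "verts G"] by (auto simp: well_order_on_def)
  then have "?P (card (verts G))"
    using G by (intro exI[of _ r]) (auto simp: simple_graph_def intro!: card_mono)
  then have "?P (arrangeability G)"
    unfolding arrangeability_def by (rule LeastI)
  then show ?thesis using that by blast
qed

lemma linear_order_on_finite_has_last:
  assumes r: "linear_order_on V r" and P: "finite P" "P \<noteq> {}" "P \<subseteq> V"
  obtains m where "m \<in> P" "\<And>x. x \<in> P \<Longrightarrow> x \<noteq> m \<Longrightarrow> strictly_before r x m"
proof -
  have "\<exists>m\<in>P. \<forall>x\<in>P. x \<noteq> m \<longrightarrow> strictly_before r x m"
    using P
  proof (induction P rule: finite_ne_induct)
    case (insert a P)
    then obtain m where m: "m \<in> P" "\<forall>x\<in>P. x \<noteq> m \<longrightarrow> strictly_before r x m" by auto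
    have "a \<noteq> m" "a \<in> V" "m \<in> V" using insert m by auto
    then consider "strictly_before r a m" | "strictly_before r m a"
      using r by (auto simp: strictly_before_def linear_order_on_def total_on_def)
    then show ?case
    proof cases
      case 1
      then show ?thesis using m by auto
    next
      case 2
      have "trans r" "antisym r"
        using r by (auto simp: linear_order_on_def partial_order_on_def preorder_on_def)
      then have "strictly_before r x a" if "x \<in> P" for x
        using that m 2 unfolding strictly_before_def by (metis antisymD transD)
      then show ?thesis by blast
    qed
  qed auto
  then show ?thesis using that by blast
qed

text \<open>Each edge of a subgraph is charged to its later endpoint, which receives at most
  \<open>(2 * k + 1) * \<rho>\<close> edges. The remaining factor 2 is that of the average
  degree.\<close>

lemma mad_bound:
  fixes G :: "'a ugraph" and k :: nat
  assumes G: "simple_graph G" and k: "arrangeability G \<le> k" and \<Sigma>: "neighborhood_system G \<Sigma>"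
  shows "mad G \<Sigma> \<le> real (2 * (2 * k + 1)) * real (rho G \<Sigma>)"
proof -
  define V where "V = verts G"
  have V: "finite V" using G by (simp add: V_def simple_graph_def)
  have NV: "neighbors G v \<subseteq> V" for v using neighbors_subset[OF G] by (simp add: V_def)
  have \<Sigma>N: "\<Sigma> w \<subseteq> neighbors G w" if "w \<in> V" for w
    using \<Sigma> that by (simp add: neighborhood_system_def V_def)
  have \<Sigma>fin: "finite (\<Sigma> w)" if "w \<in> V" for w
    using V by (rule finite_subset[OF subset_trans[OF \<Sigma>N[OF that] NV]])
  have \<Sigma>\<rho>: "card (\<Sigma> w) \<le> rho G \<Sigma>" if "w \<in> V" for w
    using card_le_rho[OF G] that by (simp add: V_def)
  obtain r where r: "linear_order_on V r" and arr: "\<forall>v\<in>V.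
      card {u \<in> V. strictly_before r u v \<and>
        (\<exists>w \<in> neighbors G u \<inter> neighbors G v. strictly_before r v w)} \<le> arrangeability G"
    using arrangeability_witness[OF G] unfolding V_def by blast
  define L where "L v = {u \<in> V. strictly_before r u v \<and>
        (\<exists>w \<in> neighbors G u \<inter> neighbors G v. strictly_before r v w)}" for v
  have L: "card (L v) \<le> k" if "v \<in> V" for v
    using bspec[OF arr that] k by (simp add: L_def)
  have total: "strictly_before r u v \<or> strictly_before r v u" if "u \<in> V" "v \<in> V" "u \<noteq> v" for u v
    using r that by (auto simp: strictly_before_def linear_order_on_def total_on_def)
  define E where "E v = {w \<in> neighbors G v. strictly_before r w v}" for v
  have Efin: "finite (E v)" for v
    using NV V finite_subset by (fastforce simp: E_def)
  have E: "card (E v) \<le> k + 1" if "v \<in> V" for v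
  proof (cases "E v = {}")
    case False
    have EV: "E v \<subseteq> V" using NV by (auto simp: E_def)
    from linear_order_on_finite_has_last[OF r Efin False EV] obtain m
      where m: "m \<in> E v" "\<And>x. x \<in> E v \<Longrightarrow> x \<noteq> m \<Longrightarrow> strictly_before r x m" by blast
    \<comment> \<open>Any other earlier neighbor of \<open>v\<close> precedes \<open>m\<close> and
      shares with it the neighbor \<open>v\<close>, which comes after \<open>m\<close>.\<close>
    have "E v - {m} \<subseteq> L m"
      using m EV neighbors_sym[of v G] by (auto simp: L_def E_def)
    then have "card (E v - {m}) \<le> card (L m)"
      using V by (intro card_mono) (auto simp: L_def)
    then show ?thesis using L[of m] m(1) EV by auto
  qed simp
  define B where "B v = {u \<in> V. strictly_before r u v \<and> (\<exists>w\<in>V. {u, v} \<subseteq> \<Sigma> w)}" for v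
  have Bfin: "finite (B v)" for v using V by (auto simp: B_def)
  have B: "card (B v) \<le> (2 * k + 1) * rho G \<Sigma>" if v: "v \<in> V" for v
  \<comment> \<open>Absorbing the additive \<open>k\<close> into \<open>k * \<rho>\<close> requires
    a positive \<open>\<rho>\<close>.\<close>
  proof (cases "rho G \<Sigma> = 0")
    case True
    then have "\<Sigma> w = {}" if "w \<in> V" for w using \<Sigma>\<rho>[OF that] \<Sigma>fin[OF that] by simp
    then have "B v = {}" by (auto simp: B_def)
    then show ?thesis by simp
  next
    case False
    have "B v \<subseteq> L v \<union> (\<Union>w\<in>E v. \<Sigma> w)"
    proof
      fix u assume "u \<in> B v"
      then obtain w where u: "u \<in> V" "strictly_before r u v" and w: "w \<in> V" "u \<in> \<Sigma> w" "v \<in> \<Sigma> w"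
        by (auto simp: B_def)
      have N: "w \<in> neighbors G u" "w \<in> neighbors G v"
        using w \<Sigma>N neighbors_sym[of w G] by blast+
      then have "w \<noteq> v" using neighbors_irrefl[OF G] by blast
      then show "u \<in> L v \<union> (\<Union>w\<in>E v. \<Sigma> w)"
        using total[OF w(1) v] u w N by (auto simp: L_def E_def)
    qed
    then have "card (B v) \<le> card (L v \<union> (\<Union>w\<in>E v. \<Sigma> w))"
    proof (rule card_mono[rotated])
      show "finite (L v \<union> (\<Union>w\<in>E v. \<Sigma> w))"
        using V Efin \<Sigma>fin NV by (force simp: L_def E_def)
    qed
    also have "\<dots> \<le> card (L v) + card (\<Union>w\<in>E v. \<Sigma> w)" by (rule card_Un_le)
    also have "card (\<Union>w\<in>E v. \<Sigma> w) \<le> (\<Sum>w\<in>E v. card (\<Sigma> w))" by (rule card_UN_le[OF Efin])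
    also have "\<dots> \<le> card (E v) * rho G \<Sigma>"
      using sum_bounded_above[of "E v" "\<lambda>w. card (\<Sigma> w)" "rho G \<Sigma>"] \<Sigma>\<rho> NV
      by (force simp: E_def)
    also have "\<dots> \<le> (k + 1) * rho G \<Sigma>" using E[OF v] by (rule mult_le_mono1)
    also have "card (L v) \<le> k * rho G \<Sigma>"
    proof -
      have "k \<le> k * rho G \<Sigma>" using False by simp
      then show ?thesis using L[OF v] by linarith
    qed
    finally show ?thesis by (simp add: algebra_simps)
  qed
  have "average_degree H \<le> real (2 * (2 * k + 1)) * real (rho G \<Sigma>)"
    if H: "subgraph H (system_graph G \<Sigma>)" "verts H \<noteq> {}" for H
  proof -
    have HV: "verts H \<subseteq> V" "finite (verts H)"
      using H V finite_subset by (auto simp: subgraph_def system_graph_def V_def)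
    have "edges H \<subseteq> (\<Union>v\<in>verts H. (\<lambda>u. {u, v}) ` B v)"
    proof
      fix e assume e: "e \<in> edges H"
      then have "e \<in> edges (system_graph G \<Sigma>)" "e \<subseteq> verts H"
        using H by (auto simp: subgraph_def simple_graph_def)
      then obtain u v w where "e = {u, v}" "u \<noteq> v" "w \<in> V" "u \<in> \<Sigma> w" "v \<in> \<Sigma> w"
          "u \<in> verts H" "v \<in> verts H"
        by (auto simp: system_graph_def V_def)
      then show "e \<in> (\<Union>v\<in>verts H. (\<lambda>u. {u, v}) ` B v)"
        using total[of u v] HV(1) by (auto simp: B_def image_iff insert_commute subset_iff)
    qed
    then have "card (edges H) \<le> card (\<Union>v\<in>verts H. (\<lambda>u. {u, v}) ` B v)"
      using HV Bfin by (intro card_mono) auto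
    also have "\<dots> \<le> (\<Sum>v\<in>verts H. card ((\<lambda>u. {u, v}) ` B v))"
      by (rule card_UN_le[OF HV(2)])
    also have "\<dots> \<le> of_nat (card (verts H)) * ((2 * k + 1) * rho G \<Sigma>)"
    proof (rule sum_bounded_above)
      fix v assume "v \<in> verts H"
      then show "card ((\<lambda>u. {u, v}) ` B v) \<le> (2 * k + 1) * rho G \<Sigma>"
        using B[of v] HV(1) card_image_le[OF Bfin, of "\<lambda>u. {u, v}" v] by auto
    qed
    finally have "real (card (edges H)) \<le> real (card (verts H) * ((2 * k + 1) * rho G \<Sigma>))"
      by (simp only: of_nat_le_iff of_nat_id)
    then show ?thesis
      using H(2) HV(2) by (simp add: average_degree_def field_simps card_gt_0_iff)
  qed
  then show ?thesis
    unfolding mad_def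
    by (intro max_average_degree_leI[OF simple_graph_system_graph[OF G]]) auto
qed

(* The supremum is taken in ennreal, where the supremum of the empty set is 0. *)
theorem theorem7:
  fixes F :: "'a ugraph set"
  assumes "\<And>G. G \<in> F \<Longrightarrow> simple_graph G"
  shows
    "((\<exists>C::real. \<forall>G\<in>F. \<forall>\<Sigma>. neighborhood_system G \<Sigma> \<longrightarrow> mad G \<Sigma> \<le> C * real (rho G \<Sigma>))
        \<longleftrightarrow> (\<exists>k. \<forall>G\<in>F. arrangeability G \<le> k)) \<and>
     ((\<exists>f::nat \<Rightarrow> real. \<forall>G\<in>F. \<forall>\<Sigma>. neighborhood_system G \<Sigma> \<longrightarrow> mad G \<Sigma> \<le> f (rho G \<Sigma>))
        \<longleftrightarrow> (\<exists>k. \<forall>G\<in>F. arrangeability G \<le> k)) \<and>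
     ((SUP (G, \<Sigma>) \<in> {(G, \<Sigma>). G \<in> F \<and> neighborhood_system G \<Sigma> \<and> rho G \<Sigma> = 2}. ennreal (mad G \<Sigma>)) < \<infinity>
        \<longleftrightarrow> (\<exists>k. \<forall>G\<in>F. arrangeability G \<le> k))"
proof -
  let ?i = "\<exists>C::real. \<forall>G\<in>F. \<forall>\<Sigma>. neighborhood_system G \<Sigma> \<longrightarrow> mad G \<Sigma> \<le> C * real (rho G \<Sigma>)"
  let ?ii = "\<exists>f::nat \<Rightarrow> real. \<forall>G\<in>F. \<forall>\<Sigma>. neighborhood_system G \<Sigma> \<longrightarrow> mad G \<Sigma> \<le> f (rho G \<Sigma>)"
  let ?I = "{(G, \<Sigma>). G \<in> F \<and> neighborhood_system G \<Sigma> \<and> rho G \<Sigma> = 2}"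
  let ?s = "SUP (G, \<Sigma>) \<in> ?I. ennreal (mad G \<Sigma>)"
  let ?iv = "\<exists>k. \<forall>G\<in>F. arrangeability G \<le> k"
  \<comment> \<open>The cycle (iv), (i), (ii), (iii), (iv) yields all three equivalences.\<close>
  have "?iv \<Longrightarrow> ?i"
    using mad_bound assms by blast
  moreover have "?i \<Longrightarrow> ?ii"
  proof -
    assume ?i
    then obtain C :: real where
      "\<forall>G\<in>F. \<forall>\<Sigma>. neighborhood_system G \<Sigma> \<longrightarrow> mad G \<Sigma> \<le> C * real (rho G \<Sigma>)" by blast
    then show ?ii by (intro exI[of _ "\<lambda>n. C * real n"])
  qed
  moreover have "?ii \<Longrightarrow> ?s < \<infinity>"
  proof -
    assume ?ii
    then obtain f :: "nat \<Rightarrow> real" where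
      f: "\<And>G \<Sigma>. G \<in> F \<Longrightarrow> neighborhood_system G \<Sigma> \<Longrightarrow> mad G \<Sigma> \<le> f (rho G \<Sigma>)" by blast
    have "?s \<le> ennreal (f 2)"
    proof (rule SUP_least)
      fix x assume "x \<in> ?I"
      then show "(case x of (G, \<Sigma>) \<Rightarrow> ennreal (mad G \<Sigma>)) \<le> ennreal (f 2)"
        using f by (auto intro!: ennreal_leI split: prod.splits) metis
    qed
    also have "\<dots> < \<infinity>" by simp
    finally show "?s < \<infinity>" .
  qed
  moreover have "?s < \<infinity> \<Longrightarrow> ?iv"
  proof -
    assume "?s < \<infinity>"
    then obtain c where c: "0 \<le> c" "?s = ennreal c"
      by (cases "?s" rule: ennreal_cases) auto
    \<comment> \<open>The finite supremum is rounded up because the counting bounds are over natural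
      numbers.\<close>
    obtain M :: nat where M: "c \<le> real M" using real_arch_simple by blast
    have "mad G \<Sigma> \<le> real M" if "G \<in> F" "neighborhood_system G \<Sigma>" "rho G \<Sigma> = 2" for G \<Sigma>
    proof -
      have "ennreal (mad G \<Sigma>) \<le> ?s"
        by (rule SUP_upper2[of "(G, \<Sigma>)"]) (use that in auto)
      then have "mad G \<Sigma> \<le> c" using c by simp
      then show ?thesis using M by simp
    qed
    then show ?iv using arrangeability_bound[OF assms] by blast
  qed
  ultimately show ?thesis by (intro conjI iffI) blast+
qed

end
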